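(* Let $G$ be a connected graph and let $e\in E(G)$ be an edge that is not a bridge of $G$. Then $$\chi'^t_d(G)-2\leq \chi'^t_d(G-e)\leq \chi'^t_d(G)+2.$$
   Context: Graphs are simple. Two edges are adjacent if they are distinct and share an endpoint. A total dominator edge coloring (TDE-coloring) of a graph $G$ is a proper edge coloring of $G$ in which each edge of $G$ is adjacent to every edge of some color class (a color class is the set of all edges assigned a given used color). The total dominator edge chromatic number $\chi'^t_d(G)$ is the minimum number of color classes in a TDE-coloring of $G$. $G-e$ is the graph obtained from $G$ by removing the edge $e$ (keeping all vertices). *)

theory Defs
  imports Main
begin

definition simple_graph :: "'v set \<Rightarrow> 'v set set \<Rightarrow> bool" where
  "simple_graph V E \<longleftrightarrow> finite V \<and> (\<forall>e\<in>E. e \<subseteq> V \<and> card e = 2)"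

definition adj_rel :: "'v set set \<Rightarrow> ('v \<times> 'v) set" where
  "adj_rel E = {(u, v). {u, v} \<in> E}"

definition connected_graph :: "'v set \<Rightarrow> 'v set set \<Rightarrow> bool" where
  "connected_graph V E \<longleftrightarrow> V \<noteq> {} \<and> (\<forall>u\<in>V. \<forall>v\<in>V. (u, v) \<in> (adj_rel E)\<^sup>*)"

definition components :: "'v set \<Rightarrow> 'v set set \<Rightarrow> 'v set set" where
  "components V E = (\<lambda>u. {v\<in>V. (u, v) \<in> (adj_rel E)\<^sup>*}) ` V"

text \<open>Deleting an edge keeps all vertices, so \<open>G - e\<close> is the pair \<open>V\<close>, \<open>E - {e}\<close>.\<close>

definition bridge :: "'v set \<Rightarrow> 'v set set \<Rightarrow> 'v set \<Rightarrow> bool" where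
  "bridge V E e \<longleftrightarrow> e \<in> E \<and> card (components V E) < card (components V (E - {e}))"

definition adjacent_edges :: "'v set \<Rightarrow> 'v set \<Rightarrow> bool" where
  "adjacent_edges e f \<longleftrightarrow> e \<noteq> f \<and> e \<inter> f \<noteq> {}"

definition proper_edge_coloring :: "'v set set \<Rightarrow> ('v set \<Rightarrow> nat) \<Rightarrow> bool" where
  "proper_edge_coloring E c \<longleftrightarrow> (\<forall>e\<in>E. \<forall>f\<in>E. adjacent_edges e f \<longrightarrow> c e \<noteq> c f)"

text \<open>Only used colors count: every color class is a nonempty set of edges.\<close>

definition color_classes :: "'v set set \<Rightarrow> ('v set \<Rightarrow> nat) \<Rightarrow> 'v set set set" where
  "color_classes E c = (\<lambda>i. {f\<in>E. c f = i}) ` (c ` E)"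

definition tde_coloring :: "'v set set \<Rightarrow> ('v set \<Rightarrow> nat) \<Rightarrow> bool" where
  "tde_coloring E c \<longleftrightarrow> proper_edge_coloring E c \<and>
     (\<forall>e\<in>E. \<exists>C\<in>color_classes E c. \<forall>f\<in>C. adjacent_edges e f)"

text \<open>
  For finite \<open>E\<close> the minimum below is over a nonempty set whenever every edge has an
  adjacent edge; see \<open>tde_coloring_exists\<close>. Otherwise the value is unspecified.
\<close>

definition tde_chromatic_number :: "'v set set \<Rightarrow> nat" where
  "tde_chromatic_number E = (LEAST k. \<exists>c. tde_coloring E c \<and> card (color_classes E c) = k)"

lemma tde_coloring_exists:
  fixes E :: "'v set set"
  assumes "finite E" and adj: "\<forall>e\<in>E. \<exists>f\<in>E. adjacent_edges e f"
  shows "\<exists>c. tde_coloring E c"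
proof -
  obtain c :: "'v set \<Rightarrow> nat" where c: "inj_on c E"
    using finite_imp_inj_to_nat_seg[OF assms(1)] by (elim exE conjE)
  have "proper_edge_coloring E c"
    unfolding proper_edge_coloring_def adjacent_edges_def
    by (intro ballI impI) (simp add: inj_on_eq_iff[OF c])
  moreover have "\<exists>C\<in>color_classes E c. \<forall>f\<in>C. adjacent_edges e f" if e: "e \<in> E" for e
  proof -
    obtain f where f: "f \<in> E" "adjacent_edges e f" using bspec[OF adj e] by (elim bexE)
    have "adjacent_edges e g" if "g \<in> {g\<in>E. c g = c f}" for g
    proof -
      have "g = f" using that f(1) inj_onD[OF c, of g f] by simp
      then show ?thesis using f(2) by simp
    qed
    moreover have "{g\<in>E. c g = c f} \<in> color_classes E c"
      unfolding color_classes_def by (intro imageI f(1))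
    ultimately show ?thesis by (intro bexI ballI)
  qed
  ultimately show ?thesis unfolding tde_coloring_def by (intro exI conjI ballI)
qed

end

theory Submission
  imports Defs
begin

text \<open>
  Both inequalities come from one operation on colorings: give every edge of a small set \<open>S\<close> a
  fresh color of its own, so that each edge of \<open>S\<close> becomes a singleton color class
  (\<open>isolate_edges\<close>). This refines the coloring and costs at most \<open>card S\<close> further colors, and
  refining a coloring preserves both properness and domination, because an edge adjacent to a
  whole class is adjacent to every nonempty part of it.

  To pass from \<open>G - e\<close> to \<open>G\<close>, isolate \<open>e\<close> and one edge \<open>f\<close> adjacent to \<open>e\<close>: the singleton
  \<open>{f}\<close> dominates \<open>e\<close>, and no class used by another edge has grown.

  To pass from \<open>G\<close> to \<open>G - e\<close>, the restricted coloring can fail only if \<open>{e}\<close> is a color class;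
  then deleting \<open>e\<close> saves one color, so three edges may be isolated. The edges that lose their
  dominating class all meet \<open>e = {u, v}\<close>. Four singleton classes repair the damage: an
  edge \<open>d\<close> at \<open>u\<close> dominates all other edges at \<open>u\<close>, an edge \<open>f\<close> at \<open>v\<close> dominates all other
  edges at \<open>v\<close>, and \<open>d\<close> and \<open>f\<close> are dominated by an adjacent edge each. Isolating all four
  would be one too many. But \<open>e\<close> itself was dominated in \<open>G\<close> by a class \<open>D\<close>, which is a matching
  of edges meeting \<open>e\<close> and hence has at most one edge at each end of \<open>e\<close>. Taking \<open>d\<close> in \<open>D\<close>, and
  \<open>f\<close> in \<open>D\<close> too if \<open>D\<close> has a second edge, isolating \<open>f\<close> turns \<open>d\<close> into a singleton for free.

  That the required neighbouring edges exist in \<open>G - e\<close> follows from its being connected, which is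
  what the hypothesis that \<open>e\<close> is not a bridge provides.
\<close>

section \<open>Colorings in terms of colors\<close>

lemma card_color_classes: "card (color_classes E c) = card (c ` E)"
proof -
  have "inj_on (\<lambda>i. {f\<in>E. c f = i}) (c ` E)" by (rule inj_onI) blast
  then show ?thesis unfolding color_classes_def by (rule card_image)
qed

text \<open>
  Naming a color class by one of its members \<open>h\<close> makes it evident that domination survives
  refinement: the same \<open>h\<close> serves for the finer coloring.
\<close>

lemma tde_coloring_iff:
  "tde_coloring E c \<longleftrightarrow> proper_edge_coloring E c \<and>
     (\<forall>k\<in>E. \<exists>h\<in>E. \<forall>g\<in>E. c g = c h \<longrightarrow> adjacent_edges k g)"
proof -
  have "(\<exists>C\<in>color_classes E c. \<forall>f\<in>C. adjacent_edges k f) \<longleftrightarrow>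
      (\<exists>h\<in>E. \<forall>g\<in>E. c g = c h \<longrightarrow> adjacent_edges k g)" for k
    unfolding color_classes_def image_image bex_simps(7) by blast
  then show ?thesis unfolding tde_coloring_def by simp
qed

lemma tde_chromatic_number_le:
  assumes "tde_coloring E c"
  shows "tde_chromatic_number E \<le> card (c ` E)"
  unfolding tde_chromatic_number_def card_color_classes
  by (rule Least_le) (use assms in blast)

lemma tde_chromatic_number_attained:
  assumes "tde_coloring E c0"
  obtains c where "tde_coloring E c" "card (c ` E) = tde_chromatic_number E"
proof -
  have "\<exists>k c. tde_coloring E c \<and> card (c ` E) = k" using assms by blast
  from LeastI_ex[OF this] show ?thesis
    using that unfolding tde_chromatic_number_def card_color_classes by blast
qed

text \<open>
  The count on the right is over \<open>E - S\<close>, since the old colors of \<open>S\<close> do not matter; this allows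
  \<open>S\<close> to contain an edge that the old coloring was never meant to color.
\<close>

lemma isolate_edges:
  fixes c :: "'a \<Rightarrow> nat"
  assumes "finite E" "S \<subseteq> E"
  obtains c' :: "'a \<Rightarrow> nat" where
    "\<forall>f\<in>E. \<forall>g\<in>E. c' f = c' g \<longrightarrow> c f = c g"
    "\<forall>s\<in>S. \<forall>f\<in>E. c' f = c' s \<longrightarrow> f = s"
    "card (c' ` E) \<le> card (c ` (E - S)) + card S"
proof -
  have fS: "finite S" using assms finite_subset by blast
  obtain i :: "'a \<Rightarrow> nat" where i: "inj_on i S"
    using finite_imp_inj_to_nat_seg[OF fS] by blast
  obtain M where M: "c f < M" if "f \<in> E" for f
    using finite_nat_set_iff_bounded[of "c ` E"] assms(1) by auto
  define c' where "c' f = (if f \<in> S then M + i f else c f)" for f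
  have iso: "f = s" if "s \<in> S" "f \<in> E" "c' f = c' s" for s f
    using that M[of f] inj_onD[OF i] by (auto simp: c'_def split: if_splits)
  have ref: "c f = c g" if "f \<in> E" "g \<in> E" "c' f = c' g" for f g
    using that iso[of f g] iso[of g f] by (cases "f \<in> S \<or> g \<in> S") (auto simp: c'_def)
  have "c' ` E = c ` (E - S) \<union> c' ` S"
    using assms(2) by (auto simp: c'_def image_def)
  then have "card (c' ` E) \<le> card (c ` (E - S)) + card (c' ` S)"
    using card_Un_le by metis
  also have "\<dots> \<le> card (c ` (E - S)) + card S" using card_image_le[OF fS] by simp
  finally show ?thesis using that[of c'] iso ref by blast
qed

section \<open>Connectivity and adjacent edges\<close>

lemma crossing_edge:
  assumes "(a, w) \<in> (adj_rel E)\<^sup>*" "a \<in> A" "w \<notin> A"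
  obtains x y where "{x, y} \<in> E" "x \<in> A" "y \<notin> A"
proof -
  from assms have "\<exists>x y. {x, y} \<in> E \<and> x \<in> A \<and> y \<notin> A"
    by (induction rule: rtrancl_induct) (auto simp: adj_rel_def)
  then show ?thesis using that by blast
qed

lemma connected_graph_delete_non_bridge:
  assumes "finite V" "connected_graph V E" "e \<in> E" "\<not> bridge V E e"
  shows "connected_graph V (E - {e})"
proof -
  have ne: "V \<noteq> {}" and conn: "\<And>u v. u \<in> V \<Longrightarrow> v \<in> V \<Longrightarrow> (u, v) \<in> (adj_rel E)\<^sup>*"
    using assms(2) by (auto simp: connected_graph_def)
  let ?comp = "\<lambda>u. {v\<in>V. (u, v) \<in> (adj_rel (E - {e}))\<^sup>*}"
  have "components V E = {V}" using ne conn by (auto simp: components_def)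
  then have "card (components V (E - {e})) \<le> Suc 0"
    using assms(3,4) by (auto simp: bridge_def)
  moreover have "finite (components V (E - {e}))"
    using assms(1) by (simp add: components_def)
  ultimately have *: "\<forall>A\<in>components V (E - {e}). \<forall>B\<in>components V (E - {e}). A = B"
    using card_le_Suc0_iff_eq by metis
  have same: "?comp u = ?comp v" if "u \<in> V" "v \<in> V" for u v
  proof -
    have "?comp u \<in> components V (E - {e})" "?comp v \<in> components V (E - {e})"
      using that unfolding components_def by (auto intro: imageI)
    then show ?thesis using * by (meson bspec)
  qed
  have "(u, v) \<in> (adj_rel (E - {e}))\<^sup>*" if "u \<in> V" "v \<in> V" for u v
  proof -
    have "v \<in> ?comp v" using that by simp
    then show ?thesis unfolding same[OF that, symmetric] by simp
  qed
  then show ?thesis using ne by (auto simp: connected_graph_def)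
qed

text \<open>
  A path from an end of \<open>f\<close> to a vertex off \<open>f\<close> leaves \<open>f\<close> along an edge adjacent to \<open>f\<close>.
\<close>

lemma adjacent_edge_exists:
  assumes "connected_graph V E" "f \<in> E" "f \<subseteq> V" "f \<noteq> {}" "\<not> V \<subseteq> f"
  obtains g where "g \<in> E" "adjacent_edges f g"
proof -
  obtain a w where "a \<in> f" "w \<in> V" "w \<notin> f" using assms by blast
  moreover from this have "(a, w) \<in> (adj_rel E)\<^sup>*"
    using assms by (auto simp: connected_graph_def)
  ultimately obtain x y where xy: "{x, y} \<in> E" "x \<in> f" "y \<notin> f"
    by (metis crossing_edge)
  then have "adjacent_edges f {x, y}" by (auto simp: adjacent_edges_def)
  then show ?thesis using that xy(1) by blast
qed

section \<open>Adding and deleting an edge\<close>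

lemma tde_coloring_insert_edge:
  fixes E :: "'a set set"
  assumes "finite E" "f \<in> E" "e \<in> E" "adjacent_edges e f" "tde_coloring (E - {e}) c"
  obtains c' where "tde_coloring E c'" "card (c' ` E) \<le> card (c ` (E - {e})) + 2"
proof -
  have "f \<noteq> e" using assms(4) by (auto simp: adjacent_edges_def)
  have dom: "\<exists>h\<in>E - {e}. \<forall>g\<in>E - {e}. c g = c h \<longrightarrow> adjacent_edges k g"
    if "k \<in> E - {e}" for k
    using assms(5) that by (auto simp: tde_coloring_iff)
  have proper: "c x \<noteq> c y" if "x \<in> E - {e}" "y \<in> E - {e}" "adjacent_edges x y" for x y
    using assms(5) that by (auto simp: tde_coloring_iff proper_edge_coloring_def)
  have sub: "{e, f} \<subseteq> E" using assms(2,3) by simp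
  obtain c' :: "'a set \<Rightarrow> nat" where finer: "\<forall>x\<in>E. \<forall>y\<in>E. c' x = c' y \<longrightarrow> c x = c y"
    and single: "\<forall>s\<in>{e, f}. \<forall>x\<in>E. c' x = c' s \<longrightarrow> x = s"
    and card: "card (c' ` E) \<le> card (c ` (E - {e, f})) + card {e, f}"
    by (rule isolate_edges[OF assms(1) sub, of c])
  note ref = finer[rule_format] and iso = single[rule_format]
  have "proper_edge_coloring E c'"
    unfolding proper_edge_coloring_def
  proof (intro ballI impI notI)
    fix x y assume xy: "x \<in> E" "y \<in> E" "adjacent_edges x y" "c' x = c' y"
    then have "x \<noteq> y" by (auto simp: adjacent_edges_def)
    then have "x \<noteq> e" "y \<noteq> e" using iso[of e] xy by auto
    then show False using proper[of x y] ref[of x y] xy by simp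
  qed
  moreover have "\<exists>h\<in>E. \<forall>g\<in>E. c' g = c' h \<longrightarrow> adjacent_edges k g" if k: "k \<in> E" for k
  proof (cases "k = e")
    case True
    have "adjacent_edges k g" if "g \<in> E" "c' g = c' f" for g
    proof -
      have "g = f" using iso[of f g] that by simp
      then show ?thesis using \<open>k = e\<close> assms(4) by simp
    qed
    then show ?thesis using assms(2) by blast
  next
    case False
    then obtain h where h: "h \<in> E" "h \<noteq> e"
      "\<And>g. \<lbrakk>g \<in> E; g \<noteq> e; c g = c h\<rbrakk> \<Longrightarrow> adjacent_edges k g"
      using dom[of k] k by blast
    have "adjacent_edges k g" if g: "g \<in> E" "c' g = c' h" for g
    proof -
      have "g \<noteq> e" using iso[of e h] h(1,2) g(2) by auto
      then show ?thesis using h(3)[OF g(1) _ ref[OF g(1) h(1) g(2)]] by simp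
    qed
    then show ?thesis using h(1) by blast
  qed
  ultimately have "tde_coloring E c'" by (simp add: tde_coloring_iff)
  moreover have "card (c ` (E - {e, f})) \<le> card (c ` (E - {e}))"
    using assms(1) by (intro card_mono image_mono) auto
  ultimately show ?thesis using that[of c'] card \<open>f \<noteq> e\<close> by simp
qed

text \<open>
  The hypotheses on \<open>at_end\<close> and \<open>adj\<close> are the traces of connectivity that the repair needs:
  both ends of \<open>e\<close> keep an edge, and every remaining edge keeps a neighbour. If \<open>e\<close> shares its
  color with another edge, the rest of its class still dominates whatever the class dominated;
  otherwise the color of \<open>e\<close> disappears, and three isolated edges cost two colors on balance.
\<close>

lemma tde_coloring_delete_edge:
  fixes E :: "'a set set"
  assumes "finite E" "e \<in> E" "e = {u, v}"
    and at_end: "\<And>w. w \<in> e \<Longrightarrow> \<exists>f\<in>E - {e}. w \<in> f"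
    and adj: "\<And>f. f \<in> E - {e} \<Longrightarrow> \<exists>g\<in>E - {e}. adjacent_edges f g"
    and tde: "tde_coloring E c"
  obtains c' where "tde_coloring (E - {e}) c'" "card (c' ` (E - {e})) \<le> card (c ` E) + 2"
proof -
  have dom: "\<exists>h\<in>E. \<forall>g\<in>E. c g = c h \<longrightarrow> adjacent_edges k g" if "k \<in> E" for k
    using tde that by (auto simp: tde_coloring_iff)
  have proper: "c x \<noteq> c y" if "x \<in> E" "y \<in> E" "adjacent_edges x y" for x y
    using tde that by (auto simp: tde_coloring_iff proper_edge_coloring_def)
  show ?thesis
  proof (cases "\<exists>r\<in>E - {e}. c r = c e")
    case True
    then obtain r where r: "r \<in> E - {e}" "c r = c e" by blast
    have "\<exists>h\<in>E - {e}. \<forall>g\<in>E - {e}. c g = c h \<longrightarrow> adjacent_edges k g" if k: "k \<in> E - {e}" for k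
    proof -
      obtain h where h: "h \<in> E" "\<forall>g\<in>E. c g = c h \<longrightarrow> adjacent_edges k g"
        using dom[of k] k by blast
      show ?thesis
      proof (cases "h = e")
        case True
        then show ?thesis using r h(2) by (intro bexI[of _ r]) auto
      next
        case False
        then show ?thesis using h by (intro bexI[of _ h]) auto
      qed
    qed
    moreover have "proper_edge_coloring (E - {e}) c"
      using proper by (auto simp: proper_edge_coloring_def)
    ultimately have "tde_coloring (E - {e}) c" by (simp add: tde_coloring_iff)
    moreover have "card (c ` (E - {e})) \<le> card (c ` E)"
      using assms(1) by (intro card_mono image_mono) auto
    ultimately show ?thesis using that[of c] by simp
  next
    case False
    obtain d where d: "d \<in> E" and D: "\<And>g. \<lbrakk>g \<in> E; c g = c d\<rbrakk> \<Longrightarrow> adjacent_edges e g"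
      using dom[OF \<open>e \<in> E\<close>] by blast
    have "adjacent_edges e d" using D d by blast
    then have "d \<noteq> e" and "d \<inter> e \<noteq> {}" by (auto simp: adjacent_edges_def)
    then obtain p q where pq: "e = {p, q}" "p \<in> d" using assms(3) by blast
    \<comment> \<open>The class of \<open>d\<close> is a matching of edges meeting \<open>e\<close>, and \<open>d\<close> already covers the end \<open>p\<close>:
      a second member lies at \<open>q\<close>, and there is at most one.\<close>
    have "\<exists>f\<in>E - {e}. q \<in> f \<and> (\<forall>x\<in>E. c x = c d \<longrightarrow> x = d \<or> x = f)"
    proof (cases "\<exists>x\<in>E. c x = c d \<and> x \<noteq> d")
      case True
      then obtain f where f: "f \<in> E" "c f = c d" "f \<noteq> d" by blast
      have at_q: "q \<in> x" if "x \<in> E" "c x = c d" "x \<noteq> d" for x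
        using D[of x] proper[of x d] d pq that by (auto simp: adjacent_edges_def)
      have "x = f" if "x \<in> E" "c x = c d" "x \<noteq> d" for x
        using at_q[OF that] at_q[OF f] proper[of x f] that f by (auto simp: adjacent_edges_def)
      then have "\<forall>x\<in>E. c x = c d \<longrightarrow> x = d \<or> x = f" by blast
      moreover have "e \<noteq> f" using D[OF f(1,2)] by (simp add: adjacent_edges_def)
      ultimately show ?thesis using f(1) at_q[OF f] by blast
    next
      case False
      then show ?thesis using at_end[of q] pq(1) by blast
    qed
    then obtain f where f: "f \<in> E - {e}" "q \<in> f"
      and Df: "\<And>x. \<lbrakk>x \<in> E; c x = c d\<rbrakk> \<Longrightarrow> x = d \<or> x = f" by blast
    obtain g where g: "g \<in> E - {e}" "adjacent_edges d g" using adj d \<open>d \<noteq> e\<close> by blast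
    obtain h where h: "h \<in> E - {e}" "adjacent_edges f h" using adj f by blast
    have fin: "finite (E - {e})" and sub: "{f, g, h} \<subseteq> E - {e}"
      using assms(1) f(1) g(1) h(1) by simp_all
    obtain c' :: "'a set \<Rightarrow> nat" where finer: "\<forall>x\<in>E - {e}. \<forall>y\<in>E - {e}. c' x = c' y \<longrightarrow> c x = c y"
      and single: "\<forall>s\<in>{f, g, h}. \<forall>x\<in>E - {e}. c' x = c' s \<longrightarrow> x = s"
      and card: "card (c' ` (E - {e})) \<le> card (c ` (E - {e} - {f, g, h})) + card {f, g, h}"
      by (rule isolate_edges[OF fin sub, of c])
    note ref = finer[rule_format] and iso = single[rule_format]
    \<comment> \<open>Isolating \<open>f\<close> has made \<open>d\<close> a singleton class as well.\<close>
    have iso_d: "x = d" if "x \<in> E - {e}" "c' x = c' d" for x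
      using Df[of x] ref[of x d] iso[of f d] that d \<open>d \<noteq> e\<close> by auto
    have "\<exists>l\<in>E - {e}. \<forall>x\<in>E - {e}. c' x = c' l \<longrightarrow> adjacent_edges k x" if k: "k \<in> E - {e}" for k
    proof -
      obtain l where l: "l \<in> E" "\<forall>x\<in>E. c x = c l \<longrightarrow> adjacent_edges k x"
        using dom[of k] k by blast
      show ?thesis
      proof (cases "l = e")
        case False
        have "adjacent_edges k x" if "x \<in> E - {e}" "c' x = c' l" for x
          using l ref[of x l] that \<open>l \<noteq> e\<close> by simp
        then show ?thesis using l(1) \<open>l \<noteq> e\<close> by blast
      next
        case True
        \<comment> \<open>The lost class \<open>{e}\<close> is replaced by one of the singletons \<open>{d}\<close>, \<open>{g}\<close>, \<open>{f}\<close>, \<open>{h}\<close>.\<close>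
        then have "p \<in> k \<or> q \<in> k" using l pq(1) by (auto simp: adjacent_edges_def)
        then have "adjacent_edges k d \<or> k = d \<or> adjacent_edges k f \<or> k = f"
          using pq(2) f(2) by (auto simp: adjacent_edges_def)
        then obtain m where m: "m \<in> E - {e}" "adjacent_edges k m" "m = d \<or> m \<in> {f, g, h}"
          using d \<open>d \<noteq> e\<close> f(1) g h by blast
        have "adjacent_edges k x" if "x \<in> E - {e}" "c' x = c' m" for x
        proof -
          have "x = m" using m(3) iso[of m x] iso_d[of x] that by blast
          then show ?thesis using m(2) by simp
        qed
        then show ?thesis using m(1) by blast
      qed
    qed
    moreover have "proper_edge_coloring (E - {e}) c'"
      unfolding proper_edge_coloring_def
    proof (intro ballI impI notI)
      fix x y assume "x \<in> E - {e}" "y \<in> E - {e}" "adjacent_edges x y" "c' x = c' y"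
      then show False using proper[of x y] ref[of x y] by simp
    qed
    ultimately have "tde_coloring (E - {e}) c'" by (simp add: tde_coloring_iff)
    moreover have "card (c' ` (E - {e})) \<le> card (c ` E) + 2"
    proof -
      have "card (c ` (E - {e} - {f, g, h})) \<le> card (c ` E - {c e})"
        using assms(1) False by (intro card_mono) auto
      also have "\<dots> < card (c ` E)"
        using assms(1,2) by (intro card_Diff1_less) auto
      finally have "card (c ` (E - {e} - {f, g, h})) < card (c ` E)" .
      moreover have "card {f, g, h} \<le> 3" by (simp add: card_insert_if)
      ultimately show ?thesis using card by linarith
    qed
    ultimately show ?thesis using that by blast
  qed
qed

section \<open>The effect on the total dominator edge chromatic number\<close>

theorem theorem3p1:
  fixes V :: "'v set" and E :: "'v set set" and e :: "'v set"
  assumes "simple_graph V E"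
    and "connected_graph V E"
    and "e \<in> E"
    and "\<not> bridge V E e"
  shows "int (tde_chromatic_number E) - 2 \<le> int (tde_chromatic_number (E - {e})) \<and>
         int (tde_chromatic_number (E - {e})) \<le> int (tde_chromatic_number E) + 2"
proof -
  let ?E' = "E - {e}"
  have finV: "finite V" and EV: "\<And>f. f \<in> E \<Longrightarrow> f \<subseteq> V" and card2: "\<And>f. f \<in> E \<Longrightarrow> card f = 2"
    using assms(1) by (auto simp: simple_graph_def)
  have finE: "finite E" using finV EV by (auto intro: finite_subset[of E "Pow V"])
  obtain u v where uv: "e = {u, v}" "u \<noteq> v" using card2[OF assms(3)] by (auto simp: card_2_iff)
  have conn: "connected_graph V ?E'"
    using connected_graph_delete_non_bridge finV assms(2-4) by blast
  have at_end: "\<exists>f\<in>?E'. w \<in> f" if "w \<in> e" for w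
  proof -
    obtain w' where "w' \<in> e" "w' \<noteq> w" using uv by blast
    moreover from this have "(w, w') \<in> (adj_rel ?E')\<^sup>*"
      using conn EV[OF assms(3)] that by (auto simp: connected_graph_def)
    ultimately obtain x y where "{x, y} \<in> ?E'" "x \<in> {w}"
      using crossing_edge[of w w' ?E' "{w}"] by blast
    then show ?thesis by blast
  qed
  have adj: "\<exists>g\<in>?E'. adjacent_edges f g" if "f \<in> ?E'" for f
  proof -
    have "finite f" using that EV finV finite_subset by blast
    \<comment> \<open>Two distinct edges span at least three vertices.\<close>
    then have "\<not> e \<subseteq> f"
      using card2[of f] card2[of e] that assms(3) card_subset_eq[of f e] by auto
    then show ?thesis
      using adjacent_edge_exists[OF conn that] that EV assms(3) card2[of f]
      by (metis DiffD1 card.empty order_trans zero_neq_numeral)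
  qed
  obtain c0 where "tde_coloring ?E' c0"
    using tde_coloring_exists[of ?E'] finE adj by blast
  then obtain c1 where c1: "tde_coloring ?E' c1" "card (c1 ` ?E') = tde_chromatic_number ?E'"
    by (rule tde_chromatic_number_attained)
  obtain f where f: "f \<in> E" "adjacent_edges e f"
    using at_end[of u] uv(1) by (auto simp: adjacent_edges_def)
  obtain c2 where c2: "tde_coloring E c2" "card (c2 ` E) \<le> tde_chromatic_number ?E' + 2"
    using tde_coloring_insert_edge[OF finE f(1) assms(3) f(2) c1(1)] c1(2) by auto
  obtain c3 where c3: "tde_coloring E c3" "card (c3 ` E) = tde_chromatic_number E"
    using tde_chromatic_number_attained[OF c2(1)] by blast
  obtain c4 where c4: "tde_coloring ?E' c4" "card (c4 ` ?E') \<le> tde_chromatic_number E + 2"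
    using tde_coloring_delete_edge[OF finE assms(3) uv(1) at_end adj c3(1)] c3(2) by auto
  show ?thesis
    using tde_chromatic_number_le[OF c2(1)] c2(2) tde_chromatic_number_le[OF c4(1)] c4(2)
    by linarith
qed

end
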